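(* Let $(X,d)$ be a metric space equipped with a convex bicombing $[\,\cdot\,,\,\cdot\,]$. If $C \subset X$ is compact and convex, then $C$ is the closed convex hull of the set of its extremal points.
   Context: Let $(X,d)$ be a metric space and let $C([0,1],X)$ denote the set of continuous maps $[0,1]\to X$. A convex bicombing on $X$ is a map $X \times X \to C([0,1],X)$, $(x,y) \mapsto [x,y](\,\cdot\,)$, satisfying: (i) for all $x,y \in X$, $[x,y](0) = x$ and $[x,y](1) = y$; moreover $[x,x](t) = x$ for all $t\in[0,1]$; (ii) for all $x,y,x',y' \in X$ the function $t \mapsto d([x,y](t),[x',y'](t))$ is a convex function on $[0,1]$. When $[x,y]$ is used as a set it denotes the image $\{[x,y](t) : t\in[0,1]\}$. A subset $C \subset X$ is convex if $x,y \in C$ implies $[x,y] \subset C$. The closed convex hull of a subset $A \subset X$ is the smallest closed convex subset of $X$ containing $A$. Let $C \subset X$ be convex. A closed non-empty subset $E \subset C$ is called extremal if for all $x,y \in C$ for which there exists some $t \in (0,1)$ with $[x,y](t) \in E$ one has $[x,y] \subset E$. A point $p \in C$ is called extremal if $\{p\}$ is an extremal set. *)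

theory Defs
  imports "HOL-Analysis.Analysis"
begin

(* A map into C([0,1],X) is encoded as a function on all of real that is continuous on
   {0..1}; its values outside {0..1} are unconstrained and never used. *)
definition convex_bicombing :: "('a::metric_space \<Rightarrow> 'a \<Rightarrow> real \<Rightarrow> 'a) \<Rightarrow> bool" where
  "convex_bicombing \<sigma> \<longleftrightarrow>
     (\<forall>x y. continuous_on {0..1} (\<sigma> x y)) \<and>
     (\<forall>x y. \<sigma> x y 0 = x \<and> \<sigma> x y 1 = y) \<and>
     (\<forall>x. \<forall>t\<in>{0..1}. \<sigma> x x t = x) \<and>
     (\<forall>x y x' y'. convex_on {0..1} (\<lambda>t. dist (\<sigma> x y t) (\<sigma> x' y' t)))"

definition bicombing_segment :: "('a \<Rightarrow> 'a \<Rightarrow> real \<Rightarrow> 'a) \<Rightarrow> 'a \<Rightarrow> 'a \<Rightarrow> 'a set" where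
  "bicombing_segment \<sigma> x y = \<sigma> x y ` {0..1}"

definition bicombing_convex :: "('a \<Rightarrow> 'a \<Rightarrow> real \<Rightarrow> 'a) \<Rightarrow> 'a set \<Rightarrow> bool" where
  "bicombing_convex \<sigma> C \<longleftrightarrow> (\<forall>x\<in>C. \<forall>y\<in>C. bicombing_segment \<sigma> x y \<subseteq> C)"

definition closed_bicombing_hull ::
  "('a::topological_space \<Rightarrow> 'a \<Rightarrow> real \<Rightarrow> 'a) \<Rightarrow> 'a set \<Rightarrow> 'a set" where
  "closed_bicombing_hull \<sigma> A = (\<lambda>S. closed S \<and> bicombing_convex \<sigma> S) hull A"

lemma bicombing_convex_Inter:
  "(\<And>S. S \<in> \<S> \<Longrightarrow> bicombing_convex \<sigma> S) \<Longrightarrow> bicombing_convex \<sigma> (\<Inter>\<S>)"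
  unfolding bicombing_convex_def by blast

lemma closed_bicombing_hull_smallest:
  "closed (closed_bicombing_hull \<sigma> A)"
  "bicombing_convex \<sigma> (closed_bicombing_hull \<sigma> A)"
  "A \<subseteq> closed_bicombing_hull \<sigma> A"
  "closed S \<Longrightarrow> bicombing_convex \<sigma> S \<Longrightarrow> A \<subseteq> S \<Longrightarrow> closed_bicombing_hull \<sigma> A \<subseteq> S"
proof -
  have "closed (closed_bicombing_hull \<sigma> A) \<and> bicombing_convex \<sigma> (closed_bicombing_hull \<sigma> A)"
    unfolding closed_bicombing_hull_def
    by (rule hull_in) (auto intro: bicombing_convex_Inter)
  then show "closed (closed_bicombing_hull \<sigma> A)"
    and "bicombing_convex \<sigma> (closed_bicombing_hull \<sigma> A)" by blast+
  show "A \<subseteq> closed_bicombing_hull \<sigma> A"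
    unfolding closed_bicombing_hull_def by (rule hull_subset)
  show "closed S \<Longrightarrow> bicombing_convex \<sigma> S \<Longrightarrow> A \<subseteq> S \<Longrightarrow> closed_bicombing_hull \<sigma> A \<subseteq> S"
    unfolding closed_bicombing_hull_def by (rule hull_minimal) auto
qed

definition extremal_set ::
  "('a::topological_space \<Rightarrow> 'a \<Rightarrow> real \<Rightarrow> 'a) \<Rightarrow> 'a set \<Rightarrow> 'a set \<Rightarrow> bool" where
  "extremal_set \<sigma> C E \<longleftrightarrow>
     closed E \<and> E \<noteq> {} \<and> E \<subseteq> C \<and>
     (\<forall>x\<in>C. \<forall>y\<in>C. (\<exists>t\<in>{0<..<1}. \<sigma> x y t \<in> E) \<longrightarrow> bicombing_segment \<sigma> x y \<subseteq> E)"

definition extremal_point ::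
  "('a::topological_space \<Rightarrow> 'a \<Rightarrow> real \<Rightarrow> 'a) \<Rightarrow> 'a set \<Rightarrow> 'a \<Rightarrow> bool" where
  "extremal_point \<sigma> C p \<longleftrightarrow> p \<in> C \<and> extremal_set \<sigma> C {p}"

end

theory Submission
  imports Defs
begin

text \<open>
  The argument is the classical one for the Krein-Milman theorem, with distance functions in the
  role of the linear functionals.  Maximizing a convex continuous function over a face of \<open>C\<close> cuts
  out a smaller face, so on a minimal face \<open>E\<close>, which exists by compactness and Zorn's lemma, every
  such function is constant.  The distance to a point \<open>p\<close> of \<open>E\<close> is one of them, by comparing a
  segment with the constant segment \<open>[p,p]\<close>; it vanishes at \<open>p\<close>, hence on \<open>E\<close>, so
  \<open>E = {p}\<close>.  Thus every face contains an extremal point (\<open>face_contains_extremal_point\<close>).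

  Now let \<open>H\<close> be the closed convex hull of the extremal points.  The distance to \<open>H\<close> is again a
  convex function, so the set of points of \<open>C\<close> farthest from \<open>H\<close> is a face and contains an extremal
  point.  That point is in \<open>H\<close>, so the maximal distance is zero and \<open>C \<subseteq> H\<close>.

  The bicombing is not assumed consistent: a piece of a segment \<open>[x,y]\<close> need not be the segment
  between its own endpoints.  So the comparison with segments of \<open>H\<close> bounds the distance to \<open>H\<close> along
  \<open>[x,y]\<close> by its values at \<open>x\<close> and \<open>y\<close>, but does not show it to be a convex function of the
  parameter.  For this reason convexity of functions is only required with respect to endpoints, and the faces
  below are only required to contain the endpoints of a segment that they meet in its interior,
  whereas an extremal set contains all of it.  For one-point sets the two notions agree, since
  \<open>[p,p]\<close> is constant.
\<close>

definition bicombing_convex_fun ::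
  "('a \<Rightarrow> 'a \<Rightarrow> real \<Rightarrow> 'a) \<Rightarrow> 'a set \<Rightarrow> ('a \<Rightarrow> real) \<Rightarrow> bool" where
  "bicombing_convex_fun \<sigma> C f \<longleftrightarrow>
     (\<forall>x\<in>C. \<forall>y\<in>C. \<forall>t\<in>{0..1}. f (\<sigma> x y t) \<le> (1 - t) * f x + t * f y)"

definition bicombing_face ::
  "('a::topological_space \<Rightarrow> 'a \<Rightarrow> real \<Rightarrow> 'a) \<Rightarrow> 'a set \<Rightarrow> 'a set \<Rightarrow> bool" where
  "bicombing_face \<sigma> C E \<longleftrightarrow>
     closed E \<and> E \<noteq> {} \<and> E \<subseteq> C \<and>
     (\<forall>x\<in>C. \<forall>y\<in>C. \<forall>t\<in>{0<..<1}. \<sigma> x y t \<in> E \<longrightarrow> x \<in> E \<and> y \<in> E)"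

text \<open>The only segments of \<open>C\<close> that meet a one-point face in their interior are those from \<open>p\<close> to
  \<open>p\<close>, and these are constant.\<close>

lemma bicombing_face_singleton:
  assumes "convex_bicombing \<sigma>" "bicombing_face \<sigma> C {p}"
  shows "extremal_point \<sigma> C p"
proof -
  have "bicombing_segment \<sigma> p p = {p}"
    using assms(1) by (simp add: convex_bicombing_def bicombing_segment_def image_constant_conv)
  moreover have "x = p \<and> y = p" if "x \<in> C" "y \<in> C" "t \<in> {0<..<1}" "\<sigma> x y t = p" for x y t
    using assms(2) that unfolding bicombing_face_def by blast
  ultimately have "\<forall>x\<in>C. \<forall>y\<in>C. (\<exists>t\<in>{0<..<1}. \<sigma> x y t \<in> {p}) \<longrightarrow>
      bicombing_segment \<sigma> x y \<subseteq> {p}"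
    by (metis order_refl singletonD)
  moreover have "p \<in> C"
    using assms(2) by (simp add: bicombing_face_def)
  ultimately show ?thesis
    unfolding extremal_point_def extremal_set_def by simp
qed

lemma dist_bicombing_le:
  assumes "convex_bicombing \<sigma>" "t \<in> {0..1}"
  shows "dist (\<sigma> x y t) (\<sigma> x' y' t) \<le> (1 - t) * dist x x' + t * dist y y'"
proof -
  have "convex_on {0..1} (\<lambda>t. dist (\<sigma> x y t) (\<sigma> x' y' t))"
    using assms(1) by (auto simp: convex_bicombing_def)
  from convex_onD[OF this, of t 0 1] show ?thesis
    using assms by (simp add: convex_bicombing_def)
qed

lemma bicombing_convex_fun_dist:
  assumes "convex_bicombing \<sigma>"
  shows "bicombing_convex_fun \<sigma> C (dist p)"
  unfolding bicombing_convex_fun_def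
proof (intro ballI)
  fix x y and t :: real
  assume t: "t \<in> {0..1}"
  have "\<sigma> p p t = p"
    using assms t by (auto simp: convex_bicombing_def)
  then show "dist p (\<sigma> x y t) \<le> (1 - t) * dist p x + t * dist p y"
    using dist_bicombing_le[OF assms t, of p p x y] by simp
qed

text \<open>The nearest points in \<open>H\<close> to \<open>x\<close> and \<open>y\<close> may not exist, but almost nearest points \<open>h\<close> and
  \<open>k\<close> do, and \<open>[h,k]\<close> stays in \<open>H\<close>, so the distance from \<open>[x,y]\<close> to \<open>[h,k]\<close> at the same
  parameter bounds the distance to \<open>H\<close>.\<close>

lemma bicombing_convex_fun_infdist:
  assumes "convex_bicombing \<sigma>" "bicombing_convex \<sigma> H"
  shows "bicombing_convex_fun \<sigma> C (\<lambda>x. infdist x H)"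
proof (cases "H = {}")
  case True
  then show ?thesis
    by (simp add: bicombing_convex_fun_def infdist_def)
next
  case False
  show ?thesis
    unfolding bicombing_convex_fun_def
  proof (rule ballI, rule ballI, rule ballI, rule field_le_epsilon)
    fix x y and t e :: real
    assume t: "t \<in> {0..1}" and e: "0 < e"
    have near: "\<exists>h\<in>H. dist z h < infdist z H + e" for z
    proof -
      have "(INF h\<in>H. dist z h) < infdist z H + e"
        using e False by (simp add: infdist_notempty)
      then show ?thesis
        using False by (subst (asm) cINF_less_iff) auto
    qed
    from near obtain h k where h: "h \<in> H" "dist x h < infdist x H + e"
      and k: "k \<in> H" "dist y k < infdist y H + e"
      by meson
    have "\<sigma> h k t \<in> H"
      using assms(2) h(1) k(1) t unfolding bicombing_convex_def bicombing_segment_def by blast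
    then have "infdist (\<sigma> x y t) H \<le> dist (\<sigma> x y t) (\<sigma> h k t)"
      by (rule infdist_le)
    also have "\<dots> \<le> (1 - t) * dist x h + t * dist y k"
      by (rule dist_bicombing_le[OF assms(1) t])
    also have "\<dots> \<le> (1 - t) * (infdist x H + e) + t * (infdist y H + e)"
      using t h(2) k(2) by (intro add_mono mult_left_mono) auto
    also have "\<dots> = (1 - t) * infdist x H + t * infdist y H + e"
      by (simp add: algebra_simps)
    finally show "infdist (\<sigma> x y t) H \<le> (1 - t) * infdist x H + t * infdist y H + e" .
  qed
qed

text \<open>A convex combination of two numbers below a bound, with both weights positive, attains the
  bound only if both numbers do; so a convex function that is maximal at an interior point of a
  segment is maximal at its endpoints.\<close>

lemma bicombing_face_maximizers:
  fixes f :: "'a::metric_space \<Rightarrow> real"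
  assumes "compact C" "bicombing_face \<sigma> C E"
    and "continuous_on C f" "bicombing_convex_fun \<sigma> C f"
  shows "bicombing_face \<sigma> C {x \<in> E. \<forall>y\<in>E. f y \<le> f x}"
proof -
  have E: "closed E" "E \<noteq> {}" "E \<subseteq> C"
    using assms(2) by (auto simp: bicombing_face_def)
  have "compact E"
    using compact_Int_closed[OF assms(1) E(1)] E(3) by (simp add: Int_absorb1)
  have cont: "continuous_on E f"
    using continuous_on_subset[OF assms(3) E(3)] .
  obtain m where m: "m \<in> E" "\<forall>y\<in>E. f y \<le> f m"
    using continuous_attains_sup[OF \<open>compact E\<close> E(2) cont] by blast
  have maximizers: "{x \<in> E. \<forall>y\<in>E. f y \<le> f x} = {x \<in> E. f x = f m}"
    using m by (auto intro: antisym)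
  have "x \<in> E \<and> f x = f m \<and> y \<in> E \<and> f y = f m"
    if xy: "x \<in> C" "y \<in> C" and t: "t \<in> {0<..<1}" and z: "\<sigma> x y t \<in> E" "f (\<sigma> x y t) = f m"
    for x y t
  proof -
    have ends: "x \<in> E" "y \<in> E"
      using assms(2) xy t z unfolding bicombing_face_def by blast+
    then have le: "f x \<le> f m" "f y \<le> f m"
      using m by auto
    have "f (\<sigma> x y t) \<le> (1 - t) * f x + t * f y"
      using assms(4) xy t by (simp add: bicombing_convex_fun_def)
    then have "(1 - t) * (f m - f x) + t * (f m - f y) \<le> 0"
      using z(2) by (simp add: algebra_simps)
    moreover have "0 \<le> (1 - t) * (f m - f x)" "0 \<le> t * (f m - f y)"
      using t le by auto
    ultimately have "(1 - t) * (f m - f x) = 0" "t * (f m - f y) = 0"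
      by linarith+
    then show ?thesis
      using t ends by auto
  qed
  moreover have "closed {x \<in> E. f x = f m}"
    using continuous_closed_preimage_constant[OF cont E(1)] .
  ultimately show ?thesis
    unfolding maximizers using m(1) E(3) by (auto simp: bicombing_face_def)
qed

text \<open>Zorn's lemma for reverse inclusion: a chain of faces is a family of closed subsets of a compact
  set with the finite intersection property, so its intersection is again a face.\<close>

lemma minimal_bicombing_face:
  fixes C :: "'a::metric_space set"
  assumes "compact C" "bicombing_face \<sigma> C E"
  obtains F where "bicombing_face \<sigma> C F" "F \<subseteq> E"
    and "\<And>G. bicombing_face \<sigma> C G \<Longrightarrow> G \<subseteq> F \<Longrightarrow> G = F"
proof -
  have "E \<subseteq> C"
    using assms(2) by (simp add: bicombing_face_def)
  let ?A = "{F. bicombing_face \<sigma> C F \<and> F \<subseteq> E}"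
  let ?P = "\<lambda>F G::'a set. G \<subseteq> F"
  have po: "partial_order_on ?A (relation_of ?P ?A)"
    by (rule partial_order_on_relation_ofI) auto
  have bound: "\<exists>u\<in>?A. \<forall>F\<in>\<F>. ?P F u" if chain: "\<F> \<in> Chains (relation_of ?P ?A)" for \<F>
  proof (cases "\<F> = {}")
    case True
    then show ?thesis using assms(2) by blast
  next
    case False
    have sub: "bicombing_face \<sigma> C F" "F \<subseteq> E" if "F \<in> \<F>" for F
      using Chains_relation_of[OF chain] that by auto
    have total: "F \<subseteq> G \<or> G \<subseteq> F" if "F \<in> \<F>" "G \<in> \<F>" for F G
      using chain that by (auto simp: Chains_def relation_of_def)
    have finite_Int: "C \<inter> \<Inter>\<G> \<noteq> {}" if "finite \<G>" "\<G> \<subseteq> \<F>" for \<G>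
    proof (cases "\<G> = {}")
      case True
      then show ?thesis using assms(2) by (auto simp: bicombing_face_def)
    next
      case False
      then obtain F where F: "F \<in> \<G>" "\<And>G. G \<in> \<G> \<Longrightarrow> G \<subseteq> F \<Longrightarrow> F = G"
        using finite_has_minimal[OF \<open>finite \<G>\<close>] by blast
      then have "F \<in> \<F>" using \<open>\<G> \<subseteq> \<F>\<close> by blast
      have "F \<subseteq> G" if "G \<in> \<G>" for G
        using total[OF \<open>F \<in> \<F>\<close>, of G] F(2)[OF that] that \<open>\<G> \<subseteq> \<F>\<close> by blast
      then have "F \<subseteq> \<Inter>\<G>" by blast
      then show ?thesis
        using sub(1)[OF \<open>F \<in> \<F>\<close>] unfolding bicombing_face_def by blast
    qed
    have "C \<inter> \<Inter>\<F> \<noteq> {}"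
    proof (rule compact_imp_fip[OF assms(1) _ finite_Int])
      show "closed F" if "F \<in> \<F>" for F
        using sub(1)[OF that] by (simp add: bicombing_face_def)
    qed
    then have nonempty: "\<Inter>\<F> \<noteq> {}" by blast
    have subset: "\<Inter>\<F> \<subseteq> E"
      using sub(2) False by blast
    have ends: "x \<in> \<Inter>\<F> \<and> y \<in> \<Inter>\<F>"
      if xyt: "x \<in> C" "y \<in> C" "t \<in> {0<..<1}" "\<sigma> x y t \<in> \<Inter>\<F>" for x y t
    proof -
      have "x \<in> F \<and> y \<in> F" if "F \<in> \<F>" for F
      proof -
        have "\<sigma> x y t \<in> F"
          using xyt(4) that by blast
        then show ?thesis
          using sub(1)[OF that] xyt(1-3) unfolding bicombing_face_def by blast
      qed
      then show ?thesis by blast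
    qed
    have "bicombing_face \<sigma> C (\<Inter>\<F>)"
      unfolding bicombing_face_def
    proof (intro conjI[of "closed _"] conjI[of "_ \<noteq> _"] conjI[of "_ \<subseteq> _"] ballI impI)
      show "closed (\<Inter>\<F>)"
        using sub(1) by (intro closed_Inter) (simp add: bicombing_face_def)
      show "\<Inter>\<F> \<subseteq> C"
        using subset \<open>E \<subseteq> C\<close> by (rule subset_trans)
    qed (fact nonempty ends)+
    then have "\<Inter>\<F> \<in> ?A"
      using subset by (intro CollectI conjI)
    then show ?thesis
      by (rule bexI[rotated]) (intro ballI Inter_lower)
  qed
  have maximal: "\<exists>F\<in>?A. \<forall>G\<in>?A. G \<subseteq> F \<longrightarrow> G = F"
    by (rule predicate_Zorn[OF po]) (rule bound)
  obtain F where F: "F \<in> ?A" and min: "\<forall>G\<in>?A. G \<subseteq> F \<longrightarrow> G = F"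
    using maximal by (elim bexE)
  show ?thesis
  proof (rule that[of F])
    show "G = F" if "bicombing_face \<sigma> C G" "G \<subseteq> F" for G
      using F min that by auto
  qed (use F in auto)
qed

lemma face_contains_extremal_point:
  assumes "convex_bicombing \<sigma>" "compact C" "bicombing_face \<sigma> C E"
  obtains p where "p \<in> E" "extremal_point \<sigma> C p"
proof -
  obtain F where F: "bicombing_face \<sigma> C F" "F \<subseteq> E"
    and min: "\<And>G. bicombing_face \<sigma> C G \<Longrightarrow> G \<subseteq> F \<Longrightarrow> G = F"
    by (rule minimal_bicombing_face[OF assms(2,3)]) blast
  obtain p where p: "p \<in> F"
    using F(1) by (auto simp: bicombing_face_def)
  let ?G = "{x \<in> F. \<forall>y\<in>F. dist p y \<le> dist p x}"
  have "bicombing_face \<sigma> C ?G"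
    by (rule bicombing_face_maximizers[OF assms(2) F(1) _ bicombing_convex_fun_dist[OF assms(1)]])
      (intro continuous_intros)
  then have "?G = F"
    by (rule min) blast
  \<comment> \<open>Hence \<open>p\<close> itself is a point of \<open>F\<close> at maximal distance from \<open>p\<close>.\<close>
  then have "\<forall>y\<in>F. dist p y \<le> dist p p"
    using p by blast
  then have "F = {p}"
    using p by fastforce
  then show thesis
    using that[of p] bicombing_face_singleton[OF assms(1)] F p by auto
qed

theorem mainTheorem1:
  fixes \<sigma> :: "'a::metric_space \<Rightarrow> 'a \<Rightarrow> real \<Rightarrow> 'a"
    and C :: "'a set"
  assumes "convex_bicombing \<sigma>"
    and "compact C"
    and "bicombing_convex \<sigma> C"
  shows "C = closed_bicombing_hull \<sigma> {p. extremal_point \<sigma> C p}"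
proof
  let ?H = "closed_bicombing_hull \<sigma> {p. extremal_point \<sigma> C p}"
  note hull = closed_bicombing_hull_smallest[where \<sigma> = \<sigma> and A = "{p. extremal_point \<sigma> C p}"]
  show "?H \<subseteq> C"
    using assms(2,3) by (intro hull(4) compact_imp_closed) (auto simp: extremal_point_def)
  show "C \<subseteq> ?H"
  proof
    fix x
    assume x: "x \<in> C"
    let ?f = "\<lambda>z. infdist z ?H"
    have "bicombing_face \<sigma> C C"
      using assms(2) x by (auto simp: bicombing_face_def compact_imp_closed)
    then have "bicombing_face \<sigma> C {z \<in> C. \<forall>y\<in>C. ?f y \<le> ?f z}"
      by (rule bicombing_face_maximizers[OF assms(2) _ _
            bicombing_convex_fun_infdist[OF assms(1) hull(2)]])
        (intro continuous_intros)
    then obtain p where p: "p \<in> {z \<in> C. \<forall>y\<in>C. ?f y \<le> ?f z}" "extremal_point \<sigma> C p"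
      by (rule face_contains_extremal_point[OF assms(1,2)])
    \<comment> \<open>Besides annihilating the maximal distance, \<open>p\<close> shows that the hull is nonempty; the distance
      to the empty set is zero by convention, so it says nothing about membership.\<close>
    have "p \<in> ?H"
      using p(2) hull(3) by blast
    then have "?f x = 0"
      using p(1) x infdist_nonneg[of x ?H] by force
    then show "x \<in> ?H"
      using \<open>p \<in> ?H\<close> hull(1) by (subst in_closed_iff_infdist_zero) auto
  qed
qed

end
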